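(* Let $r>1$ be an integer and let $D$ be an $r$-congruence half-factorial domain ($r$-CHFD) such that the polynomial ring $D[X]$ is atomic and every atom of $D$ is an $r$-good atom of $D[X]$. Then $D[X]$ is an $r$-CHFD.
   Context: Domain means (commutative) integral domain; $D[X]$ is the polynomial ring in one indeterminate over $D$. An atom (irreducible element) of a domain $A$ is a nonzero nonunit that is not a product of two nonunits of $A$. $A$ is atomic if every nonzero nonunit of $A$ is a product of finitely many atoms. For an integer $r>1$, an $r$-congruence half-factorial domain ($r$-CHFD) is an atomic domain $A$ such that for each nonzero nonunit $x\in A$ the lengths (numbers of factors) of all factorizations of $x$ into atoms are congruent modulo $r$. Let $A$ be an atomic domain and $r>1$ an integer. An atomic equality is an equality $a_1\cdots a_n=b_1\cdots b_m$ in which all factors $a_i,b_j$ are atoms of $A$ ($n,m\ge 1$). It is $r$-balanced if $n\equiv m \pmod r$ and $r$-unbalanced otherwise. It is irredundant if no proper subproduct of the $a$'s is associated to a proper subproduct of the $b$'s, i.e. $\prod_{i\in I}a_i$ is not associated (equal up to a unit factor of $A$) to $\prod_{j\in J}b_j$ for all nonempty proper subsets $I\subsetneq\{1,\dots,n\}$, $J\subsetneq\{1,\dots,m\}$. An $r$-bad atom of $A$ is an atom that appears (as one of the $a_i$ or $b_j$) in some irredundant $r$-unbalanced atomic equality. An $r$-good atom of $A$ is an atom that is not $r$-bad. *)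

theory Defs
  imports
    "HOL-Computational_Algebra.Computational_Algebra"
    "HOL-Number_Theory.Cong"
begin

text \<open>
  The atoms of a domain are its \<^const>\<open>irreducible\<close> elements. Finite families of atoms are
  multisets, so the order of the factors is immaterial, but repeated factors are counted;
  subfamilies are sub-multisets.
\<close>

definition atomic_factorization :: "'a::idom multiset \<Rightarrow> 'a \<Rightarrow> bool" where
  "atomic_factorization A x \<longleftrightarrow> (\<forall>a\<in>#A. irreducible a) \<and> prod_mset A = x"

definition atomic_domain :: "'a::idom itself \<Rightarrow> bool" where
  "atomic_domain _ \<longleftrightarrow>
     (\<forall>x::'a. x \<noteq> 0 \<and> \<not> x dvd 1 \<longrightarrow> (\<exists>A. atomic_factorization A x))"

definition chfd :: "nat \<Rightarrow> 'a::idom itself \<Rightarrow> bool" where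
  "chfd r T \<longleftrightarrow> atomic_domain T \<and>
     (\<forall>x::'a. x \<noteq> 0 \<and> \<not> x dvd 1 \<longrightarrow>
        (\<forall>A B. atomic_factorization A x \<and> atomic_factorization B x \<longrightarrow>
           [size A = size B] (mod r)))"

definition associates :: "'a::idom \<Rightarrow> 'a \<Rightarrow> bool" where
  "associates x y \<longleftrightarrow> (\<exists>u. u dvd 1 \<and> x = u * y)"

text \<open>An atomic equality is a pair of nonempty multisets of atoms with the same product.\<close>

definition atomic_equality :: "'a::idom multiset \<Rightarrow> 'a multiset \<Rightarrow> bool" where
  "atomic_equality A B \<longleftrightarrow>
     A \<noteq> {#} \<and> B \<noteq> {#} \<and>
     (\<forall>a\<in>#A. irreducible a) \<and> (\<forall>b\<in>#B. irreducible b) \<and>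
     prod_mset A = prod_mset B"

definition balanced :: "nat \<Rightarrow> 'a multiset \<Rightarrow> 'a multiset \<Rightarrow> bool" where
  "balanced r A B \<longleftrightarrow> [size A = size B] (mod r)"

text \<open>Both subproducts are required to be nonempty and proper.\<close>

definition irredundant :: "'a::idom multiset \<Rightarrow> 'a multiset \<Rightarrow> bool" where
  "irredundant A B \<longleftrightarrow>
     (\<forall>I J. I \<noteq> {#} \<and> I \<subset># A \<and> J \<noteq> {#} \<and> J \<subset># B \<longrightarrow>
        \<not> associates (prod_mset I) (prod_mset J))"

definition bad_atom :: "nat \<Rightarrow> 'a::idom \<Rightarrow> bool" where
  "bad_atom r a \<longleftrightarrow> irreducible a \<and>
     (\<exists>A B. atomic_equality A B \<and> irredundant A B \<and> \<not> balanced r A B \<and>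
        (a \<in># A \<or> a \<in># B))"

definition good_atom :: "nat \<Rightarrow> 'a::idom \<Rightarrow> bool" where
  "good_atom r a \<longleftrightarrow> irreducible a \<and> \<not> bad_atom r a"

end

theory Submission imports Defs begin

text \<open>
  Let \<open>K\<close> be the quotient field of \<open>D\<close>. Splitting an equality into irredundant pieces shows that
  \<open>c\<^sub>1 \<cdots> c\<^sub>k f = b\<^sub>1 \<cdots> b\<^sub>m\<close> is balanced whenever the atoms \<open>c\<^sub>i\<close> are good: a piece containing some
  \<open>c\<^sub>i\<close> is balanced by goodness, and a piece with left-hand side \<open>f\<close> alone is trivial.
  Choose for every prime of \<open>K[X]\<close> an atom of \<open>D[X]\<close> associated to it in \<open>K[X]\<close>. Up to constants, every
  atom \<open>f\<close> of \<open>D[X]\<close> is the product of the chosen atoms that correspond to the prime factors of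
  \<open>f\<close> in \<open>K[X]\<close>, and by the observation above the lengths agree modulo \<open>r\<close> once the constants
  are counted with their lengths in \<open>D\<close>. By multiplicativity the length of any atomic
  factorization is then determined modulo \<open>r\<close> by its product.
\<close>

section \<open>Equalities with at most one atom that is not good\<close>

lemma irreducible_unit_mult:
  fixes a u :: "'a::idom"
  assumes "u dvd 1" "irreducible a"
  shows "irreducible (u * a)"
proof -
  obtain v where v: "1 = u * v" using assms(1) by (rule dvdE)
  have "u * a dvd a" using v by (metis dvd_triv_left mult.assoc mult.commute mult_1)
  moreover have "\<not> u * a dvd 1"
    using assms(2) dvd_mult_right irreducible_not_unit by blast
  ultimately show ?thesis using irreducible_mono[OF assms(2)] by blast
qed

text \<open>The unit is multiplied into one of the atoms, which is why \<open>B\<close> must be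
  nonempty. Equalities up to units thereby become genuine atomic equalities of the same
  lengths.\<close>

lemma absorb_unit_prod_mset:
  fixes u :: "'a::idom"
  assumes "u dvd 1" "B \<noteq> {#}" "\<forall>b\<in>#B. irreducible b"
  obtains B' where "\<forall>b\<in>#B'. irreducible b" "size B' = size B" "prod_mset B' = u * prod_mset B"
proof -
  obtain b C where B: "B = add_mset b C" using assms(2) by (metis multiset_cases)
  show thesis
    by (rule that[of "add_mset (u * b) C"]) (use assms B irreducible_unit_mult[OF assms(1)] in \<open>auto simp: mult.assoc\<close>)
qed

lemma prod_mset_irreducible_nonzero:
  fixes A :: "'a::idom multiset"
  shows "\<forall>a\<in>#A. irreducible a \<Longrightarrow> prod_mset A \<noteq> 0"
  by (auto simp: prod_mset_zero_iff)

lemma prod_mset_irreducible_unit_iff: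
  fixes A :: "'a::idom multiset"
  assumes "\<forall>a\<in>#A. irreducible a"
  shows "prod_mset A dvd 1 \<longleftrightarrow> A = {#}"
  using assms by (cases A) (auto simp: irreducible_def dest: dvd_mult_left)

lemma size_eq_1_if_prod_irreducible:
  fixes B :: "'a::idom multiset"
  assumes "\<forall>b\<in>#B. irreducible b" "irreducible (prod_mset B)"
  shows "size B = 1"
proof -
  obtain b C where B: "B = add_mset b C" using assms(2) by (cases B) auto
  have "b dvd 1 \<or> prod_mset C dvd 1"
    by (rule irreducibleD[OF assms(2)]) (simp add: B)
  moreover have "\<not> b dvd 1" using assms(1) B by (auto simp: irreducible_def)
  ultimately have "C = {#}" using prod_mset_irreducible_unit_iff[of C] assms(1) B by auto
  then show ?thesis using B by simp
qed

text \<open>Cancelling a pair of associated subproducts leaves the complementary subproducts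
  associated through the inverse unit. Both units are absorbed on the right, so that
  \<open>A1\<close> and \<open>A2\<close> consist of unaltered members of \<open>A\<close> and keep
  its good atoms.\<close>

lemma not_irredundant_split:
  fixes A B :: "'a::idom multiset"
  assumes irr: "\<forall>a\<in>#A. irreducible a" "\<forall>b\<in>#B. irreducible b"
    and eq: "prod_mset A = prod_mset B" and red: "\<not> irredundant A B"
  obtains A1 A2 B1 B2 where "A = A1 + A2" "A1 \<noteq> {#}" "A2 \<noteq> {#}"
    "\<forall>b\<in>#B1. irreducible b" "\<forall>b\<in>#B2. irreducible b"
    "prod_mset A1 = prod_mset B1" "prod_mset A2 = prod_mset B2" "size B = size B1 + size B2"
proof -
  obtain I J where IJ: "I \<noteq> {#}" "I \<subset># A" "J \<noteq> {#}" "J \<subset># B"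
    "associates (prod_mset I) (prod_mset J)"
    using red by (auto simp: irredundant_def)
  obtain u where u: "u dvd 1" "prod_mset I = u * prod_mset J"
    using IJ by (auto simp: associates_def)
  obtain v where v: "1 = u * v" using u(1) by (rule dvdE)
  have v1: "v dvd 1" using v by (metis dvd_triv_right)
  obtain I' where A: "A = I + I'" and I': "I' \<noteq> {#}"
    using IJ(2) by (metis subset_mset.less_imp_le subset_mset.less_irrefl add.right_neutral mset_subset_eq_exists_conv)
  obtain J' where B: "B = J + J'" and J': "J' \<noteq> {#}"
    using IJ(4) by (metis subset_mset.less_imp_le subset_mset.less_irrefl add.right_neutral mset_subset_eq_exists_conv)
  have "prod_mset J \<noteq> 0" using irr B by (intro prod_mset_irreducible_nonzero) auto
  moreover have "prod_mset J * (u * prod_mset I') = prod_mset J * prod_mset J'"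
    using eq u(2) unfolding A B by (simp add: mult_ac)
  ultimately have uI': "u * prod_mset I' = prod_mset J'" by simp
  have I'_eq: "prod_mset I' = v * prod_mset J'"
    unfolding uI'[symmetric] using v by (metis mult.assoc mult.commute mult_1)
  have irrJ: "\<forall>b\<in>#J. irreducible b" "\<forall>b\<in>#J'. irreducible b" using irr(2) B by auto
  obtain B1 where B1: "\<forall>b\<in>#B1. irreducible b" "size B1 = size J" "prod_mset B1 = u * prod_mset J"
    by (rule absorb_unit_prod_mset[OF u(1) IJ(3) irrJ(1)])
  obtain B2 where B2: "\<forall>b\<in>#B2. irreducible b" "size B2 = size J'" "prod_mset B2 = v * prod_mset J'"
    by (rule absorb_unit_prod_mset[OF v1 J' irrJ(2)])
  show thesis
    by (rule that[of I I' B1 B2]) (use A B IJ(1) I' u(2) I'_eq B1 B2 in auto)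
qed

text \<open>Induction on the length of \<open>A\<close>. A redundant equality splits into two with
  shorter left-hand sides, each of which inherits the bound on atoms that are not good. The
  right-hand side is unrestricted.\<close>

lemma balanced_if_at_most_one_not_good:
  fixes A B :: "'a::idom multiset"
  assumes "\<forall>a\<in>#A. irreducible a" "\<forall>b\<in>#B. irreducible b" "prod_mset A = prod_mset B"
    and "size (filter_mset (\<lambda>a. \<not> good_atom r a) A) \<le> 1"
  shows "[size A = size B] (mod r)"
  using assms
proof (induction "size A" arbitrary: A B rule: less_induct)
  case less
  show ?case
  proof (cases "\<exists>a\<in>#A. good_atom r a")
    \<comment> \<open>Without a good atom the bound leaves at most one atom in \<open>A\<close>, so
      the common product is 1 or an atom.\<close>
    case False
    then have "filter_mset (\<lambda>a. \<not> good_atom r a) A = A" by (simp add: filter_mset_eq_conv)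
    then have "size A \<le> 1" using less.prems(4) by simp
    then consider "A = {#}" | a where "A = {#a#}"
      by (metis le_numeral_extra(4) less_one order_le_less size_1_singleton_mset size_eq_0_iff_empty)
    then show ?thesis
    proof cases
      case 1
      then have "B = {#}"
        using less.prems(2,3) prod_mset_irreducible_unit_iff[of B] by auto
      then show ?thesis using 1 by simp
    next
      case 2
      then have "size B = 1"
        using less.prems by (intro size_eq_1_if_prod_irreducible) auto
      then show ?thesis using 2 by simp
    qed
  next
    case True
    then obtain a where a: "a \<in># A" "good_atom r a" by blast
    show ?thesis
    proof (cases "irredundant A B")
      case True
      have A: "A \<noteq> {#}" using a by auto
      then have "B \<noteq> {#}"
        using less.prems(1,3) prod_mset_irreducible_unit_iff[of A] by auto
      then have "atomic_equality A B" using less.prems A by (simp add: atomic_equality_def)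
      \<comment> \<open>If this irredundant equality were unbalanced, its member \<open>a\<close>
        would be bad.\<close>
      then show ?thesis
        using a True less.prems(1) unfolding good_atom_def bad_atom_def balanced_def by blast
    next
      case False
      obtain A1 A2 B1 B2 where s: "A = A1 + A2" "A1 \<noteq> {#}" "A2 \<noteq> {#}"
        "\<forall>b\<in>#B1. irreducible b" "\<forall>b\<in>#B2. irreducible b"
        "prod_mset A1 = prod_mset B1" "prod_mset A2 = prod_mset B2" "size B = size B1 + size B2"
        by (rule not_irredundant_split[OF less.prems(1-3) False])
      have "[size A1 = size B1] (mod r)"
        by (rule less.hyps) (use s less.prems in \<open>auto simp: nonempty_has_size\<close>)
      moreover have "[size A2 = size B2] (mod r)"
        by (rule less.hyps) (use s less.prems in \<open>auto simp: nonempty_has_size\<close>)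
      ultimately show ?thesis unfolding s(1,8) by (simp add: cong_add)
    qed
  qed
qed

section \<open>Lengths of elements\<close>

lemma atomic_domain_factorization:
  fixes x :: "'a::idom"
  assumes "atomic_domain TYPE('a)" "x \<noteq> 0"
  obtains u A where "u dvd 1" "\<forall>a\<in>#A. irreducible a" "x = u * prod_mset A"
proof (cases "x dvd 1")
  case True
  then show ?thesis by (intro that[of x "{#}"]) auto
next
  case False
  then obtain A where "atomic_factorization A x" using assms by (auto simp: atomic_domain_def)
  then show ?thesis by (intro that[of 1 A]) (auto simp: atomic_factorization_def)
qed

text \<open>Extends the defining congruence to factorizations up to units and to the units
  themselves, for which both families are empty.\<close>

lemma chfd_size_cong:
  fixes u v :: "'a::idom"
  assumes "chfd r TYPE('a)" and units: "u dvd 1" "v dvd 1"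
    and irr: "\<forall>a\<in>#A. irreducible a" "\<forall>b\<in>#B. irreducible b"
    and eq: "u * prod_mset A = v * prod_mset B"
  shows "[size A = size B] (mod r)"
proof -
  have unit_iff: "w * prod_mset C dvd 1 \<longleftrightarrow> C = {#}"
    if "w dvd 1" "\<forall>a\<in>#C. irreducible a" for w :: 'a and C
    using that prod_mset_irreducible_unit_iff[of C]
    by (metis dvd_mult_right mult_1_right prod_mset_empty)
  show ?thesis
  proof (cases "A = {#} \<or> B = {#}")
    case True
    then show ?thesis
      using unit_iff[OF units(1) irr(1)] unit_iff[OF units(2) irr(2)] eq by auto
  next
    case False
    obtain A' where A': "\<forall>a\<in>#A'. irreducible a" "size A' = size A" "prod_mset A' = u * prod_mset A"
      by (rule absorb_unit_prod_mset[OF units(1) _ irr(1)]) (use False in auto)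
    obtain B' where B': "\<forall>a\<in>#B'. irreducible a" "size B' = size B" "prod_mset B' = v * prod_mset B"
      by (rule absorb_unit_prod_mset[OF units(2) _ irr(2)]) (use False in auto)
    have "prod_mset A' \<noteq> 0" "\<not> prod_mset A' dvd 1"
      using A'(2) False prod_mset_irreducible_nonzero[OF A'(1)]
        prod_mset_irreducible_unit_iff[OF A'(1)] by auto
    then have "[size A' = size B'] (mod r)"
      using assms(1) A' B' eq unfolding chfd_def atomic_factorization_def by metis
    then show ?thesis using A' B' by simp
  qed
qed

text \<open>The length of an arbitrarily chosen factorization; in an \<open>r\<close>-CHFD its class
  modulo \<open>r\<close> does not depend on the choice. Allowing a unit factor gives units length
  0, so that length is additive modulo \<open>r\<close> on all nonzero elements.\<close>

definition atom_length :: "'a::idom \<Rightarrow> nat" where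
  "atom_length x =
     size (SOME A. (\<forall>a\<in>#A. irreducible a) \<and> (\<exists>u. u dvd 1 \<and> x = u * prod_mset A))"

lemma atom_length_cong:
  fixes u :: "'a::idom"
  assumes "chfd r TYPE('a)" "u dvd 1" "\<forall>a\<in>#A. irreducible a"
  shows "[atom_length (u * prod_mset A) = size A] (mod r)"
proof -
  let ?P = "\<lambda>B. (\<forall>a\<in>#B. irreducible a) \<and> (\<exists>v. v dvd 1 \<and> u * prod_mset A = v * prod_mset B)"
  define B where "B = (SOME B. ?P B)"
  have "?P B" unfolding B_def by (rule someI[of ?P A]) (use assms in blast)
  then obtain v where "\<forall>b\<in>#B. irreducible b" "v dvd 1" "u * prod_mset A = v * prod_mset B"
    by blast
  then have "[size A = size B] (mod r)" by (intro chfd_size_cong[OF assms(1,2) _ assms(3)])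
  then show ?thesis unfolding atom_length_def B_def by (rule cong_sym)
qed

lemma atom_length_mult_cong:
  fixes x y :: "'a::idom"
  assumes ch: "chfd r TYPE('a)" and "x \<noteq> 0" "y \<noteq> 0"
  shows "[atom_length (x * y) = atom_length x + atom_length y] (mod r)"
proof -
  have at: "atomic_domain TYPE('a)" using ch by (simp add: chfd_def)
  obtain u A where A: "u dvd 1" "\<forall>a\<in>#A. irreducible a" "x = u * prod_mset A"
    by (rule atomic_domain_factorization[OF at assms(2)])
  obtain v B where B: "v dvd 1" "\<forall>a\<in>#B. irreducible a" "y = v * prod_mset B"
    by (rule atomic_domain_factorization[OF at assms(3)])
  have uv: "u * v dvd 1" using mult_dvd_mono[OF A(1) B(1)] by simp
  have "[atom_length ((u * v) * prod_mset (A + B)) = size (A + B)] (mod r)"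
    by (rule atom_length_cong[OF ch uv]) (use A B in auto)
  moreover have "[atom_length x + atom_length y = size A + size B] (mod r)"
    unfolding A(3) B(3) by (intro cong_add atom_length_cong ch A B)
  ultimately show ?thesis
    using A(3) B(3) by (simp add: mult_ac cong_def)
qed

section \<open>Monic prime factors over a field\<close>

lemma field_poly_monic_prime_factorization_exists:
  fixes p :: "'a::field poly"
  assumes "p \<noteq> 0"
  shows "\<exists>M. (\<forall>q\<in>#M. irreducible q \<and> lead_coeff q = 1) \<and> prod_mset M = smult (inverse (lead_coeff p)) p"
proof -
  obtain M where M: "\<forall>q\<in>#M. prime_elem q" "prod_mset M = smult (inverse (lead_coeff p)) p"
    using field_poly_prod_mset_prime_factorization[OF assms]
      field_poly_in_prime_factorization_imp_prime by blast
  \<comment> \<open>Monic normalization is multiplicative, so normalizing each factor normalizes the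
    product.\<close>
  define g :: "'a poly \<Rightarrow> 'a poly" where "g = (\<lambda>q. smult (inverse (lead_coeff q)) q)"
  have "lead_coeff (prod_mset M) = 1" unfolding M(2) using assms by simp
  moreover have "prod_mset (image_mset g M) = g (prod_mset M)"
    by (induction M) (simp_all add: g_def lead_coeff_mult mult_ac)
  ultimately have "prod_mset (image_mset g M) = smult (inverse (lead_coeff p)) p"
    using M(2) by (simp add: g_def)
  moreover have "irreducible (g q) \<and> lead_coeff (g q) = 1" if "q \<in># M" for q
  proof -
    have q: "irreducible q" using M(1) that prime_elem_imp_irreducible by blast
    then have "q \<noteq> 0" by auto
    then have "irreducible ([:inverse (lead_coeff q):] * q)"
      by (intro irreducible_unit_mult q) (simp add: is_unit_pCons_iff)
    then show ?thesis using \<open>q \<noteq> 0\<close> by (simp add: g_def)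
  qed
  ultimately show ?thesis by (intro exI[of _ "image_mset g M"]) auto
qed

lemma field_poly_monic_irreducible_dvd_imp_eq:
  fixes p q :: "'a::field poly"
  assumes "irreducible p" "irreducible q" "lead_coeff p = 1" "lead_coeff q = 1" "p dvd q"
  shows "p = q"
proof -
  obtain s where s: "q = p * s" using assms(5) by (rule dvdE)
  have "s dvd 1" using irreducibleD[OF assms(2) s] assms(1) by (auto simp: irreducible_def)
  then obtain k where k: "s = [:k:]" by (auto simp: is_unit_poly_iff)
  have "lead_coeff q = k" unfolding s k lead_coeff_mult using assms(3) by simp
  then have "k = 1" using assms(4) by simp
  then show ?thesis using s k by simp
qed

text \<open>A prime \<open>p\<close> of \<open>M\<close> divides some member of \<open>N\<close>,
  and two monic primes dividing one another coincide; cancel \<open>p\<close> and induct.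
  Restricting to monic primes gives equality of multisets instead of a matching up to units.\<close>

lemma field_poly_monic_prime_factorization_unique:
  fixes M N :: "'a::field poly multiset"
  assumes "\<forall>q\<in>#M. irreducible q \<and> lead_coeff q = 1" "\<forall>q\<in>#N. irreducible q \<and> lead_coeff q = 1"
    and "prod_mset M = prod_mset N"
  shows "M = N"
  using assms
proof (induction M arbitrary: N)
  case empty
  then show ?case using prod_mset_irreducible_unit_iff[of N] by auto
next
  case (add p M)
  have p: "irreducible p" "lead_coeff p = 1" "p \<noteq> 0" using add.prems by auto
  have "p dvd prod_mset N" using add.prems(3) by (metis dvd_triv_left prod_mset.add_mset)
  then obtain q where q: "q \<in># N" "p dvd q"
    using prime_elem_dvd_prod_msetE[OF field_poly_irreducible_imp_prime[OF p(1)]] by blast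
  then have "p = q" using p add.prems(2) field_poly_monic_irreducible_dvd_imp_eq by blast
  then obtain N' where N: "N = add_mset p N'" using q(1) by (metis mset_add)
  have "M = N'" by (rule add.IH) (use add.prems N p(3) in auto)
  then show ?case using N by simp
qed

definition monic_prime_factors :: "'a::field poly \<Rightarrow> 'a poly multiset" where
  "monic_prime_factors p = (SOME M. (\<forall>q\<in>#M. irreducible q \<and> lead_coeff q = 1) \<and>
     prod_mset M = smult (inverse (lead_coeff p)) p)"

lemma monic_prime_factors:
  fixes p :: "'a::field poly"
  assumes "p \<noteq> 0"
  shows "\<forall>q\<in>#monic_prime_factors p. irreducible q \<and> lead_coeff q = 1"
    and "prod_mset (monic_prime_factors p) = smult (inverse (lead_coeff p)) p"
  unfolding monic_prime_factors_def
  using someI_ex[OF field_poly_monic_prime_factorization_exists[OF assms]] by blast+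

lemma monic_prime_factors_mult:
  fixes p q :: "'a::field poly"
  assumes "p \<noteq> 0" "q \<noteq> 0"
  shows "monic_prime_factors (p * q) = monic_prime_factors p + monic_prime_factors q"
  by (rule field_poly_monic_prime_factorization_unique)
    (use assms monic_prime_factors[of p] monic_prime_factors[of q] monic_prime_factors[of "p * q"]
      in \<open>auto simp: lead_coeff_mult mult_ac\<close>)

lemma monic_prime_factors_1: "monic_prime_factors (1 :: 'a::field poly) = {#}"
  by (rule field_poly_monic_prime_factorization_unique)
    (use monic_prime_factors[of "1 :: 'a poly"] in auto)

section \<open>Atoms of the polynomial ring and primes over the quotient field\<close>

text \<open>Induction on the coefficients: a new coefficient \<open>m/n\<close> enlarges the common
  denominator \<open>c\<close> to \<open>c * n\<close>.\<close>

lemma fract_poly_clear_denominators: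
  fixes q :: "'a::idom fract poly"
  obtains c p where "c \<noteq> 0" "smult (to_fract c) q = map_poly to_fract p"
proof -
  have "\<exists>c p. c \<noteq> 0 \<and> smult (to_fract c) q = map_poly to_fract p"
  proof (induction q)
    case 0
    show ?case by (rule exI[of _ 1], rule exI[of _ 0]) auto
  next
    case (pCons a q)
    then obtain c p where cp: "c \<noteq> 0" "smult (to_fract c) q = map_poly to_fract p" by blast
    obtain m n where a: "a = Fract m n" "n \<noteq> 0" by (cases a)
    have "smult (to_fract (c * n)) q = smult (to_fract n) (smult (to_fract c) q)"
      by (simp add: mult.commute)
    then have "smult (to_fract (c * n)) q = map_poly to_fract (smult n p)"
      unfolding cp(2) by simp
    moreover have "to_fract (c * n) * a = to_fract (c * m)"
      using a by (simp add: Fract_conv_to_fract)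
    ultimately have "smult (to_fract (c * n)) (pCons a q) = map_poly to_fract (pCons (c * m) (smult n p))"
      by (simp add: map_poly_pCons)
    then show ?case using cp(1) a(2) by (metis mult_eq_0_iff)
  qed
  then show thesis using that by blast
qed

text \<open>A nonzero constant multiple of \<open>p\<close> lies in \<open>D[X]\<close> and factors
  into atoms there. As \<open>p\<close> is prime over the quotient field, it divides one of these
  atoms; that atom in turn divides the constant multiple of \<open>p\<close>, so the two are
  associated.\<close>

lemma irreducible_fract_poly_associated_atom:
  fixes p :: "'a::idom fract poly"
  assumes at: "atomic_domain TYPE('a poly)" and "irreducible p"
  shows "\<exists>q k. irreducible q \<and> k \<noteq> 0 \<and> p = smult k (map_poly to_fract q)"
proof -
  obtain c P where c: "c \<noteq> 0" "smult (to_fract c) p = map_poly to_fract P"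
    by (rule fract_poly_clear_denominators)
  have p0: "p \<noteq> 0" "\<not> p dvd 1" using assms(2) by (auto simp: irreducible_def)
  then have "map_poly to_fract P \<noteq> 0" unfolding c(2)[symmetric] using c(1) by simp
  then have "P \<noteq> 0" by auto
  then obtain u A where A: "u dvd 1" "\<forall>a\<in>#A. irreducible a" "P = u * prod_mset A"
    by (rule atomic_domain_factorization[OF at])
  have p_dvd: "p dvd map_poly to_fract P" unfolding c(2)[symmetric] by (rule dvd_smult) simp
  have pr: "prime_elem p" using assms(2) by (rule field_poly_irreducible_imp_prime)
  have "\<not> p dvd map_poly to_fract u"
    using p0(2) fract_poly_is_unit[OF A(1)] dvd_trans by blast
  then have "p dvd map_poly to_fract (prod_mset A)"
    using p_dvd prime_elem_dvd_multD[OF pr] unfolding A(3) by auto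
  then have "p dvd (\<Prod>a\<in>#A. map_poly to_fract a)"
    using prod_mset_fract_poly[of "\<lambda>a. a" A] by simp
  then obtain a where a: "a \<in># A" "p dvd map_poly to_fract a"
    using prime_elem_dvd_prod_msetE[OF pr] by (metis in_image_mset imageE)
  have "map_poly to_fract a dvd map_poly to_fract P"
    by (rule fract_poly_dvd) (use a A(3) in \<open>simp add: dvd_mult dvd_prod_mset\<close>)
  then have "map_poly to_fract a dvd p"
    unfolding c(2)[symmetric] using c(1) by (simp add: dvd_smult_iff)
  then obtain s where s: "p = map_poly to_fract a * s" by (rule dvdE)
  \<comment> \<open>The other factor cannot be the unit, since \<open>p\<close> divides it.\<close>
  have "s dvd 1"
    using irreducibleD[OF assms(2) s] a(2) p0(2) dvd_trans by blast
  then obtain k where k: "s = [:k:]" by (auto simp: is_unit_poly_iff)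
  have "k \<noteq> 0" using p0(1) s k by auto
  then show ?thesis using a(1) A(2) s k by (intro exI[of _ a] exI[of _ k]) auto
qed

text \<open>Over the quotient field, \<open>f\<close> and the product of the representatives have
  the same primes, hence differ by a nonzero constant. Writing it as a fraction \<open>d/c\<close>
  and clearing the denominator gives an equality in \<open>D[X]\<close>.\<close>

lemma fract_poly_monic_prime_factors_associated:
  fixes f :: "'a::idom poly" and rep :: "'a fract poly \<Rightarrow> 'a poly"
  assumes "f \<noteq> 0"
    and rep: "\<And>p. irreducible p \<Longrightarrow> \<exists>k. k \<noteq> 0 \<and> p = smult k (map_poly to_fract (rep p))"
  obtains c d where "c \<noteq> 0" "d \<noteq> 0"
    "smult c f = smult d (\<Prod>p\<in>#monic_prime_factors (map_poly to_fract f). rep p)"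
proof -
  let ?F = "monic_prime_factors (map_poly to_fract f)"
  have "\<exists>k. k \<noteq> 0 \<and> prod_mset M = smult k (map_poly to_fract (\<Prod>p\<in>#M. rep p))"
    if "\<forall>p\<in>#M. irreducible p" for M
    using that
  proof (induction M)
    case empty
    show ?case by (rule exI[of _ 1]) simp
  next
    case (add p M)
    then obtain k where k: "k \<noteq> 0" "prod_mset M = smult k (map_poly to_fract (\<Prod>p\<in>#M. rep p))"
      by auto
    obtain l where l: "l \<noteq> 0" "p = smult l (map_poly to_fract (rep p))"
      using rep[of p] add.prems by auto
    have "prod_mset (add_mset p M) = p * prod_mset M" by simp
    also have "\<dots> = smult (k * l) (map_poly to_fract (\<Prod>p\<in>#add_mset p M. rep p))"
      by (subst l(2), subst k(2)) (simp add: mult_ac)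
    finally show ?case using k(1) l(1) by (metis mult_eq_0_iff)
  qed
  moreover have "\<forall>p\<in>#?F. irreducible p"
    using monic_prime_factors(1)[of "map_poly to_fract f"] assms(1) by simp
  ultimately obtain k where k: "k \<noteq> 0" "prod_mset ?F = smult k (map_poly to_fract (\<Prod>p\<in>#?F. rep p))"
    by blast
  have f0: "map_poly to_fract f \<noteq> 0" using assms(1) by simp
  \<comment> \<open>The leading coefficient undoes the monic normalization in
    \<open>monic_prime_factors\<close>.\<close>
  define l where "l = lead_coeff (map_poly to_fract f) * k"
  have l0: "l \<noteq> 0" using f0 k(1) unfolding l_def by simp
  define R where "R = (\<Prod>p\<in>#?F. rep p)"
  have f: "map_poly to_fract f = smult l (map_poly to_fract R)"
    using arg_cong[OF k(2)[unfolded monic_prime_factors(2)[OF f0]],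
        of "smult (lead_coeff (map_poly to_fract f))"] f0
    by (simp add: l_def R_def)
  obtain d c where l: "l = Fract d c" "c \<noteq> 0" by (cases l)
  have d: "d \<noteq> 0" using l l0 by (auto simp: Fract_conv_to_fract)
  have "map_poly to_fract (smult c f) = map_poly to_fract (smult d R)"
    unfolding fract_poly_smult f using l(2) by (simp add: l(1) Fract_conv_to_fract)
  then have "smult c f = smult d R" by (simp only: fract_poly_eq_iff)
  then show thesis by (intro that[OF l(2) d]) (simp add: R_def)
qed

text \<open>Here goodness enters: factoring \<open>c\<close> and \<open>d\<close> in
  \<open>D\<close> gives an atomic equality in \<open>D[X]\<close> whose left-hand side consists of
  good constants and the single atom \<open>f\<close>. The atoms in \<open>Q\<close> may be
  bad.\<close>

lemma const_mult_atom_length_cong: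
  fixes f :: "'a::idom poly"
  assumes ch: "chfd r TYPE('a)"
    and good: "\<And>a::'a. irreducible a \<Longrightarrow> good_atom r [:a:]"
    and f: "irreducible f" and Q: "\<forall>q\<in>#Q. irreducible q"
    and cd: "c \<noteq> 0" "d \<noteq> 0" and eq: "smult c f = smult d (prod_mset Q)"
  shows "[atom_length c + 1 = atom_length d + size Q] (mod r)"
proof -
  have at: "atomic_domain TYPE('a)" using ch by (simp add: chfd_def)
  obtain u C where C: "u dvd 1" "\<forall>a\<in>#C. irreducible a" "c = u * prod_mset C"
    by (rule atomic_domain_factorization[OF at cd(1)])
  obtain v E where E: "v dvd 1" "\<forall>a\<in>#E. irreducible a" "d = v * prod_mset E"
    by (rule atomic_domain_factorization[OF at cd(2)])
  obtain u' where u': "1 = u * u'" using C(1) by (rule dvdE)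
  let ?C = "image_mset (\<lambda>a. [:a:]) C" and ?E = "image_mset (\<lambda>a. [:a:]) E"
  have prodC: "prod_mset ?C = [:prod_mset C:]" and prodE: "prod_mset ?E = [:prod_mset E:]"
    using prod_mset_const_poly[of "\<lambda>a. a"] by simp_all
  have QE_ne: "Q + ?E \<noteq> {#}"
  proof
    assume "Q + ?E = {#}"
    then have "smult c f = [:v:]" using eq E(3) by simp
    then have "smult c f dvd 1" using E(1) by (simp add: is_unit_const_poly_iff)
    then have "f dvd 1" by (metis dvd_smult dvd_refl dvd_trans)
    then show False using f by (simp add: irreducible_def)
  qed
  have uv: "[:u' * v:] dvd 1"
    using mult_dvd_mono[OF _ E(1), of u' 1] u' by (metis dvd_triv_right is_unit_const_poly_iff mult_1)
  have irr: "\<forall>b\<in>#Q + ?E. irreducible b" using Q E by (auto simp: irreducible_const_poly_iff)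
  \<comment> \<open>The units of \<open>c\<close> and \<open>d\<close> are both moved to the right,
    so the atoms of \<open>C\<close> and \<open>f\<close> stay as they are.\<close>
  obtain B where B: "\<forall>b\<in>#B. irreducible b" "size B = size (Q + ?E)"
    "prod_mset B = [:u' * v:] * prod_mset (Q + ?E)"
    by (rule absorb_unit_prod_mset[OF uv QE_ne irr])
  have "prod_mset (add_mset f ?C) = smult (u * u') (prod_mset (add_mset f ?C))" using u' by simp
  also have "\<dots> = smult u' (smult c f)" by (simp add: prodC C(3) mult_ac)
  also have "\<dots> = prod_mset B" unfolding eq B(3) by (simp add: prodE E(3) mult_ac)
  finally have prod: "prod_mset (add_mset f ?C) = prod_mset B" .
  have C_good: "filter_mset (\<lambda>a. \<not> good_atom r a) ?C = {#}"
    using C(2) good by auto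
  have "size (filter_mset (\<lambda>a. \<not> good_atom r a) (add_mset f ?C)) \<le> 1"
    by (simp add: C_good)
  moreover have "\<forall>a\<in>#add_mset f ?C. irreducible a"
    using f C(2) by (auto simp: irreducible_const_poly_iff)
  ultimately have "[size (add_mset f ?C) = size B] (mod r)"
    using balanced_if_at_most_one_not_good[OF _ B(1) prod] by blast
  then have "[size C + 1 = size E + size Q] (mod r)" using B(2) by (simp add: add.commute)
  moreover have "[atom_length c + 1 = size C + 1] (mod r)"
    unfolding C(3) by (intro cong_add atom_length_cong ch C cong_refl)
  moreover have "[atom_length d + size Q = size E + size Q] (mod r)"
    unfolding E(3) by (intro cong_add atom_length_cong ch E cong_refl)
  ultimately show ?thesis unfolding cong_def by metis
qed

text \<open>Multiply the relations for the single atoms; \<open>monic_prime_factors\<close> and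
  \<open>atom_length\<close> turn products into sums, the latter modulo \<open>r\<close>. The
  reference family \<open>F (prod_mset A)\<close> depends only on the product of \<open>A\<close>,
  which allows two factorizations of one element to be compared.\<close>

lemma atomic_factorization_length_cong:
  fixes A :: "'a::idom poly multiset" and rep :: "'a fract poly \<Rightarrow> 'a poly"
  assumes ch: "chfd r TYPE('a)"
    and good: "\<And>a::'a. irreducible a \<Longrightarrow> good_atom r [:a:]"
    and rep: "\<And>p. irreducible p \<Longrightarrow> irreducible (rep p)"
      "\<And>p. irreducible p \<Longrightarrow> \<exists>k. k \<noteq> 0 \<and> p = smult k (map_poly to_fract (rep p))"
    and "\<forall>a\<in>#A. irreducible a"
  defines "F \<equiv> \<lambda>f. image_mset rep (monic_prime_factors (map_poly to_fract f))"
  shows "\<exists>c d. c \<noteq> 0 \<and> d \<noteq> 0 \<and>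
     smult c (prod_mset A) = smult d (prod_mset (F (prod_mset A))) \<and>
     [atom_length c + size A = atom_length d + size (F (prod_mset A))] (mod r)"
  using \<open>\<forall>a\<in>#A. irreducible a\<close>
proof (induction A)
  case empty
  show ?case by (rule exI[of _ 1], rule exI[of _ 1]) (simp add: F_def monic_prime_factors_1)
next
  case (add a A)
  then obtain c d where cd: "c \<noteq> 0" "d \<noteq> 0"
    "smult c (prod_mset A) = smult d (prod_mset (F (prod_mset A)))"
    "[atom_length c + size A = atom_length d + size (F (prod_mset A))] (mod r)"
    by auto
  have a: "irreducible a" "a \<noteq> 0" using add.prems by auto
  obtain c' d' where cd': "c' \<noteq> 0" "d' \<noteq> 0" "smult c' a = smult d' (prod_mset (F a))"
    unfolding F_def by (rule fract_poly_monic_prime_factors_associated[OF a(2) rep(2)])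
  have "\<forall>q\<in>#F a. irreducible q"
    using monic_prime_factors(1)[of "map_poly to_fract a"] a(2) rep(1) by (auto simp: F_def)
  then have len: "[atom_length c' + 1 = atom_length d' + size (F a)] (mod r)"
    using const_mult_atom_length_cong[OF ch good a(1) _ cd'] by blast
  have "prod_mset A \<noteq> 0" using add.prems by (intro prod_mset_irreducible_nonzero) auto
  then have F: "F (prod_mset (add_mset a A)) = F a + F (prod_mset A)"
    using a(2) by (simp add: F_def monic_prime_factors_mult)
  have "smult (c' * c) (prod_mset (add_mset a A)) = smult c' a * smult c (prod_mset A)"
    by (simp add: mult_ac)
  also have "\<dots> = smult (d' * d) (prod_mset (F (prod_mset (add_mset a A))))"
    unfolding F cd(3) cd'(3) by (simp add: mult_ac)
  finally have eq: "smult (c' * c) (prod_mset (add_mset a A)) =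
    smult (d' * d) (prod_mset (F (prod_mset (add_mset a A))))" .
  have "[atom_length (c' * c) + size (add_mset a A) =
      (atom_length c' + atom_length c) + size (add_mset a A)] (mod r)"
    by (intro cong_add atom_length_mult_cong ch cd cd' cong_refl)
  moreover have "[(atom_length c' + 1) + (atom_length c + size A) =
      (atom_length d' + size (F a)) + (atom_length d + size (F (prod_mset A)))] (mod r)"
    by (intro cong_add len cd)
  then have "[(atom_length c' + atom_length c) + size (add_mset a A) =
      (atom_length d' + atom_length d) + size (F (prod_mset (add_mset a A)))] (mod r)"
    unfolding F by (simp add: add_ac)
  moreover have "[(atom_length d' + atom_length d) + size (F (prod_mset (add_mset a A))) =
      atom_length (d' * d) + size (F (prod_mset (add_mset a A)))] (mod r)"
    by (intro cong_add cong_sym[OF atom_length_mult_cong] ch cd cd' cong_refl)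
  ultimately have len': "[atom_length (c' * c) + size (add_mset a A) =
      atom_length (d' * d) + size (F (prod_mset (add_mset a A)))] (mod r)"
    by (blast intro: cong_trans)
  have "c' * c \<noteq> 0" "d' * d \<noteq> 0" using cd cd' by simp_all
  with eq len' show ?case by blast
qed

theorem corollary16:
  fixes r :: nat
  assumes "r > 1"
    and "chfd r TYPE('a::idom)"
    and "atomic_domain TYPE('a poly)"
    and "\<And>a::'a. irreducible a \<Longrightarrow> good_atom r [:a:]"
  shows "chfd r TYPE('a poly)"
proof -
  note ch = assms(2)
  \<comment> \<open>The representatives are chosen once, so both factorizations are measured against
    the same atoms.\<close>
  obtain rep :: "'a fract poly \<Rightarrow> 'a poly" where
    rep: "\<And>p. irreducible p \<Longrightarrow> irreducible (rep p)"
      "\<And>p. irreducible p \<Longrightarrow> \<exists>k. k \<noteq> 0 \<and> p = smult k (map_poly to_fract (rep p))"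
    using irreducible_fract_poly_associated_atom[OF assms(3)] by metis
  have "[size A = size B] (mod r)"
    if A: "\<forall>a\<in>#A. irreducible a" and B: "\<forall>b\<in>#B. irreducible b"
      and eq: "prod_mset A = prod_mset B" for A B :: "'a poly multiset"
  proof -
    define Q where "Q = image_mset rep (monic_prime_factors (map_poly to_fract (prod_mset A)))"
    obtain c d where cd: "c \<noteq> 0" "d \<noteq> 0" "smult c (prod_mset A) = smult d (prod_mset Q)"
      "[atom_length c + size A = atom_length d + size Q] (mod r)"
      using atomic_factorization_length_cong[OF ch assms(4) rep A] unfolding Q_def by blast
    obtain c' d' where cd': "c' \<noteq> 0" "d' \<noteq> 0" "smult c' (prod_mset A) = smult d' (prod_mset Q)"
      "[atom_length c' + size B = atom_length d' + size Q] (mod r)"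
      using atomic_factorization_length_cong[OF ch assms(4) rep B] unfolding Q_def eq by blast
    have A0: "prod_mset A \<noteq> 0" using A by (rule prod_mset_irreducible_nonzero)
    then have Q0: "prod_mset Q \<noteq> 0" using cd by (metis smult_eq_0_iff)
    \<comment> \<open>\<open>d/c\<close> and \<open>d'/c'\<close> are both the ratio of
      \<open>prod_mset A\<close> to \<open>prod_mset Q\<close>; cross-multiplying and cancelling the
      nonzero polynomial gives \<open>c * d' = d * c'\<close>.\<close>
    have "smult (c * d') (prod_mset A * prod_mset Q) = smult c (prod_mset A) * smult d' (prod_mset Q)"
      by (simp add: mult.commute)
    also have "\<dots> = smult (d * c') (prod_mset A * prod_mset Q)"
      unfolding cd(3) cd'(3)[symmetric] by (simp add: mult_ac)
    finally have "smult (c * d' - d * c') (prod_mset A * prod_mset Q) = 0"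
      by (simp add: smult_diff_left)
    then have "c * d' = d * c'" using A0 Q0 by simp
    then have "[atom_length c + atom_length d' = atom_length d + atom_length c'] (mod r)"
      using atom_length_mult_cong[OF ch cd(1) cd'(2)] atom_length_mult_cong[OF ch cd(2) cd'(1)]
      by (simp add: cong_def)
    \<comment> \<open>In the sum of the three congruences everything except \<open>size A\<close>
      and \<open>size B\<close> occurs on both sides and cancels.\<close>
    from cong_add[OF this cong_add[OF cong_sym[OF cd(4)] cd'(4)]]
    have "[(atom_length c + atom_length d' + (atom_length d + size Q + atom_length c')) + size B =
           (atom_length c + atom_length d' + (atom_length d + size Q + atom_length c')) + size A] (mod r)"
      by (simp add: add_ac)
    then show ?thesis unfolding cong_add_lcancel_nat by (rule cong_sym)
  qed
  then show ?thesis
    using assms(3) by (simp add: chfd_def atomic_factorization_def)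
qed

end
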